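(* Let $f:\mathbb{N}\to\mathbb{C}$ be a nonzero multiplicative periodic function of period $M$. Then there exists a Dirichlet character $\theta$ modulo $t$, where $t\mid M$, such that $f(n)=\theta(n)$ for all $n$ coprime with $M$. Moreover, $$f\big(q^{\nu_q(M/t)+\ell}\big)=f\big(q^{\nu_q(M/t)}\big)\,\theta(q^{\ell})$$ for every prime $q$ and every $\ell\ge 0$. In particular, $f(q^{\nu_q(M/t)+\ell})=0$ for every prime $q\mid t$ and every $\ell>0$.
   Context: $\mathbb{N}=\{1,2,\ldots\}$. Multiplicative means $f(mn)=f(m)f(n)$ for all coprime $m,n$. $f$ is periodic of period $M\in\mathbb{N}$ if $f(n+M)=f(n)$ for all $n\in\mathbb{N}$ ($M$ need not be the minimal period). $\nu_q(n)$ denotes the $q$-adic valuation of $n$. *)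

theory Defs
  imports Complex_Main "HOL-Computational_Algebra.Primes"
begin

text \<open>
  A function on the positive integers is represented by a function on \<^typ>\<open>nat\<close> whose value
  at 0 is irrelevant: all conditions are restricted to positive arguments.
\<close>

definition multiplicative_fun :: "(nat \<Rightarrow> complex) \<Rightarrow> bool" where
  "multiplicative_fun f \<longleftrightarrow>
     (\<forall>m n. m > 0 \<longrightarrow> n > 0 \<longrightarrow> coprime m n \<longrightarrow> f (m * n) = f m * f n)"

text \<open>The period \<open>M\<close> need not be minimal.\<close>

definition has_period :: "(nat \<Rightarrow> complex) \<Rightarrow> nat \<Rightarrow> bool" where
  "has_period f M \<longleftrightarrow> M > 0 \<and> (\<forall>n>0. f (n + M) = f n)"

definition dirichlet_character :: "nat \<Rightarrow> (int \<Rightarrow> complex) \<Rightarrow> bool" where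
  "dirichlet_character t \<theta> \<longleftrightarrow>
     t > 0 \<and>
     (\<forall>a b. \<theta> (a * b) = \<theta> a * \<theta> b) \<and>
     (\<forall>a. \<theta> (a + int t) = \<theta> a) \<and>
     (\<forall>a. \<theta> a \<noteq> 0 \<longleftrightarrow> coprime a (int t))"

end

theory Submission
  imports Defs "HOL-Number_Theory.Cong"
begin

text \<open>
  Shifting an argument coprime to \<open>M\<close> by a multiple of \<open>M\<close> makes it coprime to any given \<open>m\<close>, so
  \<open>f (m * n) = f m * f n\<close> as soon as \<open>n\<close> is coprime to \<open>M\<close>. Hence \<open>f\<close> is a character on the units
  modulo \<open>M\<close>, and \<open>t\<close> is taken to be its conductor. For a prime \<open>q\<close> not dividing \<open>t\<close>, write
  \<open>M = q ^ a * N\<close> and choose a unit \<open>x\<close> modulo \<open>M\<close> congruent to \<open>q ^ l\<close> modulo \<open>N\<close>; then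
  \<open>q ^ (a + l)\<close> and \<open>q ^ a * x\<close> agree modulo \<open>M\<close>. If \<open>f m\<close> is nonzero, then comparing \<open>f (m * n)\<close>
  with \<open>f m\<close> shows that the character factors through the modulus \<open>M div gcd M m\<close>, which is
  therefore a multiple of \<open>t\<close>; for \<open>m\<close> a power of a prime divisor of \<open>t\<close> with a too large
  exponent this is impossible.
\<close>

section \<open>Lifting residues to units of another modulus\<close>

text \<open>Take \<open>y = x + L * k\<close> with \<open>k\<close> the product of the primes of
  \<open>M\<close> not dividing \<open>x\<close>. A prime of \<open>M\<close> dividing
  \<open>x\<close> divides neither \<open>L\<close> nor \<open>k\<close>, and every other prime of
  \<open>M\<close> divides \<open>k\<close> but not \<open>x\<close>; so none divides
  \<open>y\<close>.\<close>

lemma coprime_lift: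
  fixes x L M :: nat
  assumes "coprime x L" "L > 0" "M > 0"
  obtains y where "y > 0" "[y = x] (mod L)" "coprime y M"
proof -
  define k where "k = \<Prod>{p \<in> prime_factors M. \<not> p dvd x}"
  have fin: "finite {p \<in> prime_factors M. \<not> p dvd x}" by simp
  have "k > 0"
    unfolding k_def by (intro prod_pos) (auto intro: prime_gt_0_nat in_prime_factors_imp_prime)
  moreover have "coprime (x + L * k) M"
  proof (rule ccontr)
    assume "\<not> coprime (x + L * k) M"
    then obtain p where p: "prime p" "p dvd x + L * k" "p dvd M"
      using coprime_iff_gcd_eq_1 prime_factor_nat
      by (metis gcd_greatest_iff)
    show False
    proof (cases "p dvd x")
      case True
      then have "p dvd L * k" using p(2) dvd_add_right_iff by blast
      moreover have "\<not> p dvd L"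
        using True assms(1) p(1) not_prime_unit coprime_common_divisor by blast
      ultimately have "p dvd k" using p(1) prime_dvd_mult_iff by blast
      then obtain r where "r \<in> prime_factors M" "\<not> r dvd x" "p dvd r"
        using prime_dvd_prod_iff[OF fin p(1)] unfolding k_def by auto
      then show False using True p(1) by (metis in_prime_factors_imp_prime primes_dvd_imp_eq)
    next
      case False
      then have "p \<in> {p \<in> prime_factors M. \<not> p dvd x}"
        using p assms(3) by (simp add: prime_factors_dvd)
      then have "p dvd k" unfolding k_def using fin by (metis dvd_prodI)
      then show False using False p(2) by (simp add: dvd_add_left_iff)
    qed
  qed
  moreover have "[x + L * k = x] (mod L)" by (simp add: cong_def)
  ultimately show thesis using that[of "x + L * k"] assms(2) by simp
qed

section \<open>The function on units modulo the period\<close>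

locale periodic_multiplicative =
  fixes f :: "nat \<Rightarrow> complex" and M :: nat
  assumes nonzero: "\<exists>n>0. f n \<noteq> 0"
    and multiplicative: "multiplicative_fun f"
    and periodic: "has_period f M"
begin

lemma period_pos: "M > 0"
  using periodic by (simp add: has_period_def)

lemma f_one: "f 1 = 1"
proof -
  obtain n where n: "n > 0" "f n \<noteq> 0" using nonzero by blast
  have "f (n * 1) = f n * f 1"
    using multiplicative n(1) unfolding multiplicative_fun_def
    by (metis coprime_1_right zero_less_one)
  then show ?thesis using n(2) by simp
qed

lemma f_add_mult: "n > 0 \<Longrightarrow> f (n + M * k) = f n"
proof (induction k)
  case (Suc k)
  have "f ((n + M * k) + M) = f (n + M * k)"
    using periodic Suc.prems unfolding has_period_def by simp
  then show ?case using Suc by (simp add: algebra_simps)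
qed simp

lemma f_cong:
  assumes "m > 0" "n > 0" "[m = n] (mod M)"
  shows "f m = f n"
proof -
  obtain k l where "n + k * M = m + l * M"
    using assms(3) by (metis cong_iff_lin_nat)
  then show ?thesis
    using f_add_mult[OF assms(1), of l] f_add_mult[OF assms(2), of k] by (simp add: mult.commute)
qed

lemma f_mult:
  assumes "m > 0" "n > 0" "coprime n M"
  shows "f (m * n) = f m * f n"
proof -
  obtain y where y: "y > 0" "[y = n] (mod M)" "coprime y m"
    using coprime_lift[OF assms(3) period_pos assms(1)] .
  have "f (m * n) = f (m * y)"
    using assms y by (intro f_cong) (auto intro: cong_mult cong_sym)
  also have "\<dots> = f m * f y"
    using multiplicative assms(1) y unfolding multiplicative_fun_def
    by (simp add: coprime_commute)
  also have "f y = f n" using y assms by (intro f_cong)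
  finally show ?thesis .
qed

text \<open>Allows cancellation of values at units, and shows that these values are nonzero.\<close>

lemma f_inverse:
  assumes "n > 0" "coprime n M"
  obtains n' where "n' > 0" "coprime n' M" "[n * n' = 1] (mod M)" "f n * f n' = 1"
proof -
  obtain x where x: "[n * x = 1] (mod M)"
    using assms(2) cong_solve_coprime_nat by auto
  then have "coprime (n * x) M" using cong_imp_coprime cong_sym by (metis coprime_1_left)
  then have "coprime x M" by simp
  then obtain n' where n': "n' > 0" "[n' = x] (mod M)" "coprime n' M"
    using coprime_lift period_pos by metis
  have *: "[n * n' = 1] (mod M)"
    using x n'(2) by (metis cong_scalar_left cong_trans)
  have "f n * f n' = f (n * n')" using f_mult assms n' by simp
  also have "\<dots> = f 1" using assms n' * by (intro f_cong) auto
  finally show thesis using that n' * f_one by simp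
qed

section \<open>Moduli through which the character factors\<close>

text \<open>The condition is triviality on the kernel of reduction from units modulo
  \<open>M\<close> to units modulo \<open>t\<close>.\<close>

definition induced_modulus :: "nat \<Rightarrow> bool" where
  "induced_modulus t \<longleftrightarrow> t dvd M \<and> (\<forall>n>0. coprime n M \<longrightarrow> [n = 1] (mod t) \<longrightarrow> f n = 1)"

lemma induced_modulus_pos: "induced_modulus t \<Longrightarrow> t > 0"
  using period_pos by (auto simp: induced_modulus_def intro: Nat.gr0I)

lemma induced_modulus_self: "induced_modulus M"
  unfolding induced_modulus_def
  using f_cong f_one by (metis dvd_refl zero_less_one)

lemma induced_modulus_cong:
  assumes "induced_modulus t" "m > 0" "n > 0" "coprime m M" "coprime n M" "[m = n] (mod t)"
  shows "f m = f n"
proof -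
  obtain n' where n': "n' > 0" "coprime n' M" "[n * n' = 1] (mod M)" "f n * f n' = 1"
    using f_inverse assms by metis
  have "[m * n' = n * n'] (mod t)" using assms(6) cong_scalar_right by blast
  moreover have "[n * n' = 1] (mod t)"
    using n'(3) assms(1) cong_dvd_modulus_nat induced_modulus_def by blast
  ultimately have "[m * n' = 1] (mod t)" by (rule cong_trans)
  then have "f (m * n') = 1"
    using assms n' unfolding induced_modulus_def by simp
  then have "f m * f n' = f n * f n'" using f_mult[of m n'] assms n' by simp
  moreover have "f n' \<noteq> 0" using n'(4) by auto
  ultimately show ?thesis by simp
qed

text \<open>A unit \<open>n\<close> that is 1 modulo the gcd admits a unit \<open>y\<close> that is
  \<open>n\<close> modulo \<open>t\<close> and 1 modulo \<open>d\<close>. The two hypotheses then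
  give \<open>f n = f y = 1\<close>.\<close>

lemma induced_modulus_gcd:
  assumes "induced_modulus t" "induced_modulus d"
  shows "induced_modulus (gcd t d)"
  unfolding induced_modulus_def
proof (intro conjI allI impI)
  show "gcd t d dvd M" using assms(1) by (auto simp: induced_modulus_def intro: dvd_trans)
  fix n assume n: "n > 0" "coprime n M" "[n = 1] (mod gcd t d)"
  have dvd: "t dvd M" "d dvd M" using assms by (auto simp: induced_modulus_def)
  have pos: "t > 0" "d > 0" using assms induced_modulus_pos by auto
  \<comment> \<open>Chinese remaindering for moduli that need not be coprime: \<open>n\<close> and 1
    agree modulo the gcd, and Bezout's identity gives \<open>x = d * u * k + 1\<close>.\<close>
  have "\<exists>x. [x = n] (mod t) \<and> [x = 1] (mod d)"
  proof -
    obtain k where k: "n = k * gcd t d + 1"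
      using n(1,3) by (metis Suc_leI One_nat_def cong_le_nat cong_sym mult.commute)
    obtain u where u: "[d * u = gcd d t] (mod t)"
      using cong_solve_nat pos by (metis gr_implies_not0)
    have "[d * (u * k) + 1 = n] (mod t)"
      using cong_add[OF cong_scalar_right[OF u, of k] cong_refl[of 1]] k
      by (simp add: mult_ac gcd.commute)
    moreover have "[d * (u * k) + 1 = 1] (mod d)" unfolding cong_def by (rule mod_mult_self4)
    ultimately show ?thesis by blast
  qed
  then obtain x where x: "[x = n] (mod t)" "[x = 1] (mod d)" by blast
  have "coprime n t" using n(2) dvd(1) coprime_divisors dvd_refl by blast
  then have "coprime x t" using x(1) cong_imp_coprime cong_sym by blast
  moreover have "coprime x d" using x(2) cong_imp_coprime cong_sym by (metis coprime_1_left)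
  \<comment> \<open>\<open>x\<close> may share a factor with \<open>M\<close>, so it is replaced by
    a unit modulo \<open>M\<close> in the same class modulo \<open>t * d\<close>.\<close>
  ultimately have "coprime x (t * d)" by simp
  then obtain y where y: "y > 0" "[y = x] (mod t * d)" "coprime y M"
    using coprime_lift period_pos pos by (metis nat_0_less_mult_iff)
  have "[y = n] (mod t)" "[y = 1] (mod d)"
    using y(2) x by (meson cong_dvd_modulus_nat cong_trans dvd_triv_left dvd_triv_right)+
  then have "f y = f n"
    using assms(1) y n by (intro induced_modulus_cong)
  moreover have "f y = 1"
    using assms(2) y \<open>[y = 1] (mod d)\<close> unfolding induced_modulus_def by blast
  ultimately show "f n = 1" by simp
qed

lemma induced_modulus_quotient:
  assumes "m > 0" "f m \<noteq> 0"
  shows "induced_modulus (M div gcd M m)"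
  unfolding induced_modulus_def
proof (intro conjI allI impI)
  show "M div gcd M m dvd M" by (metis dvd_div_mult_self dvd_triv_left gcd_dvd1)
  fix n assume n: "n > 0" "coprime n M" "[n = 1] (mod M div gcd M m)"
  \<comment> \<open>Scaling by the gcd raises the modulus to \<open>M\<close>; since
    \<open>m\<close> is a multiple of the gcd, \<open>m * n\<close> and \<open>m\<close> agree
    modulo \<open>M\<close>.\<close>
  have "[gcd M m * n = gcd M m * 1] (mod gcd M m * (M div gcd M m))"
    using n(3) unfolding cong_def by (metis mult_mod_right)
  then have "[gcd M m * n = gcd M m] (mod M)" by simp
  then have "[m div gcd M m * (gcd M m * n) = m div gcd M m * gcd M m] (mod M)"
    by (rule cong_scalar_left)
  then have "[m * n = m] (mod M)" by (simp add: mult.assoc[symmetric])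
  then have "f (m * n) = f m" using assms(1) n(1) by (intro f_cong) auto
  then show "f n = 1" using f_mult assms n by simp
qed

section \<open>The conductor and its character\<close>

definition conductor :: nat where
  "conductor = (LEAST t. induced_modulus t)"

lemma induced_modulus_conductor: "induced_modulus conductor"
  unfolding conductor_def using induced_modulus_self by (rule LeastI)

lemma conductor_pos: "conductor > 0"
  using induced_modulus_conductor by (rule induced_modulus_pos)

lemma conductor_dvd_period: "conductor dvd M"
  using induced_modulus_conductor by (simp add: induced_modulus_def)

text \<open>Induced moduli are closed under gcd, so the numerically least one is also least for
  divisibility.\<close>

lemma conductor_dvd:
  assumes "induced_modulus d"
  shows "conductor dvd d"
proof -
  have "conductor \<le> gcd conductor d"
    unfolding conductor_def[symmetric]
    using induced_modulus_gcd[OF induced_modulus_conductor assms]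
    by (metis Least_le conductor_def)
  then have "gcd conductor d = conductor"
    using gcd_le1_nat[of conductor d] conductor_pos by (intro antisym) auto
  then show ?thesis by (metis gcd_dvd2)
qed

text \<open>
  The representative has to be coprime to \<open>M\<close>: an argument coprime to the conductor may still share
  a factor with \<open>M\<close>, and there \<open>f\<close> itself need not agree with the character.
\<close>

definition character :: "int \<Rightarrow> complex" where
  "character a =
     (if coprime a (int conductor)
      then f (SOME n. n > 0 \<and> coprime n M \<and> [int n = a] (mod int conductor)) else 0)"

text \<open>Independence of the chosen representative: any two are units modulo \<open>M\<close>
  that agree modulo the conductor, so \<open>f\<close> takes the same value at both.\<close>

lemma character_eq:
  assumes "n > 0" "coprime n M" "[int n = a] (mod int conductor)"
  shows "character a = f n"
proof -
  define P where "P m \<longleftrightarrow> m > 0 \<and> coprime m M \<and> [int m = a] (mod int conductor)" for m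
  have "P n" using assms by (simp add: P_def)
  then have *: "P (Eps P)" by (rule someI)
  have "[Eps P = n] (mod conductor)"
    using * assms(3) unfolding P_def by (metis cong_int_iff cong_sym cong_trans)
  then have "f (Eps P) = f n"
    using * assms induced_modulus_conductor unfolding P_def
    by (intro induced_modulus_cong) auto
  moreover have "coprime n conductor"
    using assms(2) conductor_dvd_period coprime_divisors dvd_refl by blast
  then have "coprime a (int conductor)"
    using assms(3) cong_imp_coprime by (metis coprime_int_iff)
  ultimately show ?thesis by (simp add: character_def P_def[abs_def])
qed

lemma character_representative:
  assumes "coprime a (int conductor)"
  obtains n where "n > 0" "coprime n M" "[int n = a] (mod int conductor)"
proof -
  define x where "x = nat (a mod int conductor)"
  have x: "int x = a mod int conductor" using conductor_pos by (simp add: x_def)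
  then have "[int x = a] (mod int conductor)" by simp
  moreover from this have "coprime x conductor"
    using assms cong_imp_coprime cong_sym by (metis coprime_int_iff)
  then obtain n where "n > 0" "[n = x] (mod conductor)" "coprime n M"
    using coprime_lift conductor_pos period_pos by metis
  ultimately show thesis using that by (metis cong_int_iff cong_trans)
qed

lemma character_nonzero_iff: "character a \<noteq> 0 \<longleftrightarrow> coprime a (int conductor)"
proof
  show "character a \<noteq> 0 \<Longrightarrow> coprime a (int conductor)"
    by (auto simp: character_def split: if_splits)
  assume "coprime a (int conductor)"
  then obtain n where n: "n > 0" "coprime n M" "[int n = a] (mod int conductor)"
    by (rule character_representative)
  moreover have "f n \<noteq> 0" using f_inverse[OF n(1,2)] by (metis mult_zero_left zero_neq_one)
  ultimately show "character a \<noteq> 0" using character_eq by metis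
qed

lemma character_mult: "character (a * b) = character a * character b"
proof (cases "coprime a (int conductor) \<and> coprime b (int conductor)")
  case True
  then have ab: "coprime a (int conductor)" "coprime b (int conductor)" by auto
  obtain m where m: "m > 0" "coprime m M" "[int m = a] (mod int conductor)"
    using ab(1) by (rule character_representative)
  obtain n where n: "n > 0" "coprime n M" "[int n = b] (mod int conductor)"
    using ab(2) by (rule character_representative)
  have "[int (m * n) = a * b] (mod int conductor)" using cong_mult[OF m(3) n(3)] by simp
  then have "character (a * b) = f (m * n)" using m n by (intro character_eq) auto
  then show ?thesis using character_eq[OF m] character_eq[OF n] f_mult[OF m(1) n(1,2)] by simp
next
  case False
  then have "\<not> coprime (a * b) (int conductor)" by simp
  then have "character (a * b) = 0" using character_nonzero_iff by blast
  moreover have "character a = 0 \<or> character b = 0" using False character_nonzero_iff by blast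
  ultimately show ?thesis by auto
qed

lemma character_cong:
  assumes "[a = b] (mod int conductor)"
  shows "character a = character b"
proof (cases "coprime a (int conductor)")
  case True
  then obtain n where n: "n > 0" "coprime n M" "[int n = a] (mod int conductor)"
    by (rule character_representative)
  moreover have "[int n = b] (mod int conductor)" using n(3) assms by (rule cong_trans)
  ultimately show ?thesis using character_eq by metis
next
  case False
  moreover have "\<not> coprime b (int conductor)"
    using False assms cong_imp_coprime cong_sym by blast
  ultimately show ?thesis by (metis character_nonzero_iff)
qed

lemma dirichlet_character_character: "dirichlet_character conductor character"
  unfolding dirichlet_character_def
proof (intro conjI allI)
  show "character (a + int conductor) = character a" for a
    by (rule character_cong) (simp add: cong_def)
qed (rule conductor_pos character_mult character_nonzero_iff)+

section \<open>Values at prime powers\<close>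

text \<open>A nonzero value would make the conductor divide \<open>M div g\<close>, hence
  \<open>g\<close> divide \<open>s\<close>. But \<open>g\<close> contains one more factor
  \<open>q\<close> than \<open>s\<close> does.\<close>

lemma f_prime_power_eq_0:
  assumes "prime q" "q dvd conductor" "l > 0"
  shows "f (q ^ (multiplicity q (M div conductor) + l)) = 0"
proof (rule ccontr)
  define s where "s = M div conductor"
  define v where "v = multiplicity q s"
  define g where "g = gcd M (q ^ (v + l))"
  assume "f (q ^ (multiplicity q (M div conductor) + l)) \<noteq> 0"
  then have "induced_modulus (M div g)"
    using induced_modulus_quotient assms(1) unfolding g_def v_def s_def
    by (simp add: prime_gt_0_nat)
  then have "conductor * g dvd M div g * g" by (intro mult_dvd_mono conductor_dvd dvd_refl)
  then have "conductor * g dvd M" by (simp add: g_def)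
  moreover have M: "conductor * s = M" using conductor_dvd_period by (simp add: s_def)
  ultimately have "conductor * g dvd conductor * s" by simp
  then have "g dvd s" using conductor_pos by simp
  moreover have "q ^ Suc v dvd g"
  proof -
    \<comment> \<open>The extra factor \<open>q\<close> comes from the conductor.\<close>
    have "q * q ^ v dvd conductor * s"
      using assms(2) multiplicity_dvd by (intro mult_dvd_mono) (auto simp: v_def)
    moreover have "q ^ Suc v dvd q ^ (v + l)" using assms(3) by (intro le_imp_power_dvd) simp
    ultimately show ?thesis by (simp add: g_def M)
  qed
  ultimately have "q ^ Suc v dvd s" by (rule dvd_trans[rotated])
  moreover have "s \<noteq> 0" using M period_pos by (metis mult_0_right less_irrefl)
  ultimately have "Suc v \<le> v"
    using assms(1) unfolding v_def by (metis multiplicity_geI not_prime_unit)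
  then show False by simp
qed

lemma f_prime_power_coprime:
  assumes "prime q" "\<not> q dvd conductor"
  shows "f (q ^ (multiplicity q (M div conductor) + l)) =
           f (q ^ multiplicity q (M div conductor)) * character (int (q ^ l))"
proof -
  define s where "s = M div conductor"
  define a where "a = multiplicity q s"
  have M: "conductor * s = M" using conductor_dvd_period by (simp add: s_def)
  then have "s \<noteq> 0" using period_pos by (metis mult_0_right less_irrefl)
  then obtain r where r: "s = q ^ a * r" "\<not> q dvd r"
    unfolding a_def using assms(1) by (metis multiplicity_decompose' not_prime_unit)
  define N where "N = conductor * r"
  have "q ^ a * N = conductor * s" by (simp add: r(1) N_def mult_ac)
  then have MN: "q ^ a * N = M" using M by simp
  have "\<not> q dvd N" using assms r(2) prime_dvd_mult_iff N_def by blast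
  then have "coprime (q ^ l) N" using assms(1) by (simp add: prime_imp_coprime)
  \<comment> \<open>\<open>x\<close> does two jobs: multiplied by \<open>q ^ a\<close> it agrees
    with \<open>q ^ (a + l)\<close> modulo \<open>M\<close>, and since the conductor divides
    \<open>N\<close> it represents \<open>q ^ l\<close> in the value of the character.\<close>
  then obtain x where x: "x > 0" "[x = q ^ l] (mod N)" "coprime x M"
    using coprime_lift period_pos MN by (metis nat_0_less_mult_iff)
  have "[q ^ a * q ^ l = q ^ a * x] (mod q ^ a * N)"
    using cong_sym[OF x(2)] unfolding cong_def by (metis mult_mod_right)
  then have "[q ^ a * q ^ l = q ^ a * x] (mod M)" by (simp only: MN)
  then have "f (q ^ (a + l)) = f (q ^ a * x)"
    using assms(1) x(1) by (intro f_cong) (auto simp: power_add prime_gt_0_nat)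
  also have "\<dots> = f (q ^ a) * f x" using assms(1) x by (simp add: f_mult prime_gt_0_nat)
  also have "[x = q ^ l] (mod conductor)"
    using x(2) cong_dvd_modulus_nat N_def by (metis dvd_triv_left)
  then have "f x = character (int (q ^ l))"
    using x by (metis character_eq cong_int_iff)
  finally show ?thesis by (simp add: a_def s_def)
qed

lemma f_prime_power:
  assumes "prime q"
  shows "f (q ^ (multiplicity q (M div conductor) + l)) =
           f (q ^ multiplicity q (M div conductor)) * character (int (q ^ l))"
proof (cases "q dvd conductor \<and> l > 0")
  case True
  then have "\<not> coprime (q ^ l) conductor"
    using assms coprime_absorb_left[of q conductor] by auto
  then have "character (int (q ^ l)) = 0"
    by (metis character_nonzero_iff coprime_int_iff)
  then show ?thesis using f_prime_power_eq_0 True assms by simp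
next
  case False
  \<comment> \<open>Settles \<open>l = 0\<close> for every \<open>q\<close>, including prime
    divisors of the conductor.\<close>
  moreover have "character 1 = 1" using character_eq[of 1 1] f_one by simp
  ultimately show ?thesis using f_prime_power_coprime assms by (cases "l = 0") auto
qed

end

theorem proposition0p3:
  fixes f :: "nat \<Rightarrow> complex" and M :: nat
  assumes "\<exists>n>0. f n \<noteq> 0"
    and "multiplicative_fun f"
    and "has_period f M"
  shows "\<exists>(t :: nat) (\<theta> :: int \<Rightarrow> complex).
           t dvd M \<and> dirichlet_character t \<theta> \<and>
           (\<forall>n>0. coprime n M \<longrightarrow> f n = \<theta> (int n)) \<and>
           (\<forall>(q :: nat) (l :: nat). prime q \<longrightarrow>
              f (q ^ (multiplicity q (M div t) + l)) =
                f (q ^ multiplicity q (M div t)) * \<theta> (int (q ^ l))) \<and>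
           (\<forall>(q :: nat) (l :: nat). prime q \<longrightarrow> q dvd t \<longrightarrow> l > 0 \<longrightarrow>
              f (q ^ (multiplicity q (M div t) + l)) = 0)"
proof -
  interpret periodic_multiplicative f M
    using assms by unfold_locales
  have "\<forall>n>0. coprime n M \<longrightarrow> f n = character (int n)"
    using character_eq by simp
  then show ?thesis
    using conductor_dvd_period dirichlet_character_character f_prime_power f_prime_power_eq_0
    by blast
qed

end
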